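(* Let $g\ge3$ and $d\ge3$, and let $S_{g,d}$ be the regular sun: the cycle $C_g$ with $d-2$ pendant leaves attached at each cycle vertex. Then $S_{g,d}$ carries a discrete Einstein metric, and it is unique up to scaling among all positive edge weightings of $S_{g,d}$ (across all transport regimes, not only among balanced weightings).
   Context: Weighted graphs: $G=(V,E)$ is a finite connected simple graph, $w:E\to\mathbb{R}_{>0}$ an edge weighting, $d_v$ the combinatorial degree, and $d(x,y)$ the least total weight of a path from $x$ to $y$. Lin--Lu--Yau curvature: for $\alpha\in[0,1]$ let $\mu_x^\alpha$ be the probability measure with mass $\alpha$ at $x$ and $(1-\alpha)/d_x$ at each neighbour of $x$. Let $W$ be the $L^1$-Wasserstein distance with respect to $d$. For an edge $x\sim y$ put $\kappa_\alpha(x,y)=1-W(\mu_x^\alpha,\mu_y^\alpha)/d(x,y)$ and $\kappa_{xy}=\lim_{\alpha\to1}\kappa_\alpha(x,y)/(1-\alpha)$. A positive weighting $w$ is a discrete Einstein metric if there is a real $\kappa$ with $\kappa_e=\kappa$ for every edge $e$. Balanced: a weighting is balanced if every three consecutive cycle edges have total weight at most half the total weight of the cycle. A transport regime is a region of weightings on which $w\mapsto(\kappa_ew_e)_e$ is linear; together the regimes cover all positive weightings. *)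

theory Defs
  imports "HOL-Probability.Probability"
begin

section \<open>Weighted simple graphs\<close>

text \<open>A graph is a vertex set together with a set of two-element vertex sets. The notions below
  (neighbours, path metric, curvature) only refer to the edge set. An edge weighting is a function
  on sets whose values off the edge set are irrelevant.\<close>

definition paths :: "'v set set \<Rightarrow> 'v \<Rightarrow> 'v \<Rightarrow> 'v list set" where
  "paths E x y = {p. p \<noteq> [] \<and> hd p = x \<and> last p = y \<and> distinct p \<and>
                     successively (\<lambda>u v. {u, v} \<in> E) p}"

definition finite_connected_simple_graph :: "'v set \<Rightarrow> 'v set set \<Rightarrow> bool" where
  "finite_connected_simple_graph V E \<longleftrightarrow> finite V \<and> V \<noteq> {} \<and>
     (\<forall>e\<in>E. e \<subseteq> V \<and> card e = 2) \<and> (\<forall>x\<in>V. \<forall>y\<in>V. paths E x y \<noteq> {})"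

definition neighbours :: "'v set set \<Rightarrow> 'v \<Rightarrow> 'v set" where
  "neighbours E x = {y. {x, y} \<in> E}"

definition degree :: "'v set set \<Rightarrow> 'v \<Rightarrow> nat" where
  "degree E x = card (neighbours E x)"

definition path_weight :: "('v set \<Rightarrow> real) \<Rightarrow> 'v list \<Rightarrow> real" where
  "path_weight w p = (\<Sum>i<length p - 1. w {p ! i, p ! Suc i})"

text \<open>In a finite connected graph there are finitely many paths between two vertices, and at least
  one, so the infimum is a minimum. The weight of an edge may exceed the distance of its
  endpoints.\<close>

definition wdist :: "'v set set \<Rightarrow> ('v set \<Rightarrow> real) \<Rightarrow> 'v \<Rightarrow> 'v \<Rightarrow> real" where
  "wdist E w x y = (INF p\<in>paths E x y. path_weight w p)"

definition positive_weighting :: "'v set set \<Rightarrow> ('v set \<Rightarrow> real) \<Rightarrow> bool" where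
  "positive_weighting E w \<longleftrightarrow> (\<forall>e\<in>E. w e > 0)"


section \<open>Lin--Lu--Yau curvature\<close>

text \<open>The infimum of the transport cost over all couplings. It is only used for measures of finite
  support, for which every cost function is integrable with respect to every coupling.\<close>

definition wasserstein :: "('v \<Rightarrow> 'v \<Rightarrow> real) \<Rightarrow> 'v pmf \<Rightarrow> 'v pmf \<Rightarrow> real" where
  "wasserstein c p q =
     (INF m\<in>{m. map_pmf fst m = p \<and> map_pmf snd m = q}.
        measure_pmf.expectation m (\<lambda>(x, y). c x y))"

definition lazy_step :: "'v set set \<Rightarrow> real \<Rightarrow> 'v \<Rightarrow> 'v pmf" where
  "lazy_step E \<alpha> x =
     bind_pmf (bernoulli_pmf \<alpha>)
       (\<lambda>stay. if stay then return_pmf x else pmf_of_set (neighbours E x))"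

lemma pmf_lazy_step:
  assumes "0 \<le> \<alpha>" "\<alpha> \<le> 1" "finite (neighbours E x)" "neighbours E x \<noteq> {}" "{x} \<notin> E"
  shows "pmf (lazy_step E \<alpha> x) y =
    (if y = x then \<alpha> else if y \<in> neighbours E x then (1 - \<alpha>) / real (degree E x) else 0)"
proof -
  have "x \<notin> neighbours E x"
    using assms by (simp add: neighbours_def)
  then show ?thesis
    using assms by (auto simp: lazy_step_def pmf_bind degree_def pmf_of_set indicator_def)
qed

definition lly_kappa ::
  "'v set set \<Rightarrow> ('v set \<Rightarrow> real) \<Rightarrow> real \<Rightarrow> 'v \<Rightarrow> 'v \<Rightarrow> real" where
  "lly_kappa E w \<alpha> x y =
     1 - wasserstein (wdist E w) (lazy_step E \<alpha> x) (lazy_step E \<alpha> y) / wdist E w x y"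

definition has_lly_curvature ::
  "'v set set \<Rightarrow> ('v set \<Rightarrow> real) \<Rightarrow> 'v \<Rightarrow> 'v \<Rightarrow> real \<Rightarrow> bool" where
  "has_lly_curvature E w x y \<kappa> \<longleftrightarrow>
     ((\<lambda>\<alpha>. lly_kappa E w \<alpha> x y / (1 - \<alpha>)) \<longlongrightarrow> \<kappa>) (at_left 1)"

definition discrete_Einstein :: "'v set set \<Rightarrow> ('v set \<Rightarrow> real) \<Rightarrow> bool" where
  "discrete_Einstein E w \<longleftrightarrow> positive_weighting E w \<and>
     (\<exists>\<kappa>. \<forall>x y. {x, y} \<in> E \<longrightarrow> has_lly_curvature E w x y \<kappa>)"


section \<open>Regular suns\<close>

datatype sun_vertex = Cyc nat | Leaf nat nat

definition sun_verts :: "nat \<Rightarrow> nat \<Rightarrow> sun_vertex set" where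
  "sun_verts g d = Cyc ` {..<g} \<union> {Leaf i j | i j. i < g \<and> j < d - 2}"

definition sun_edges :: "nat \<Rightarrow> nat \<Rightarrow> sun_vertex set set" where
  "sun_edges g d = {{Cyc i, Cyc (Suc i mod g)} | i. i < g} \<union>
                   {{Cyc i, Leaf i j} | i j. i < g \<and> j < d - 2}"

lemma paths_snoc_nonempty:
  assumes "paths E x y \<noteq> {}" "{y, z} \<in> E"
  shows "paths E x z \<noteq> {}"
proof -
  obtain p where p: "p \<noteq> []" "hd p = x" "last p = y" "distinct p"
      "successively (\<lambda>u v. {u, v} \<in> E) p"
    using assms by (auto simp: paths_def)
  show ?thesis
  proof (cases "z \<in> set p")
    case True
    then obtain a b where "p = a @ z # b"
      by (meson split_list)
    then have "p = (a @ [z]) @ b" by simp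
    then have "successively (\<lambda>u v. {u, v} \<in> E) (a @ [z])" "distinct (a @ [z])"
      using p by (metis successively_append_iff, metis distinct_append)
    moreover have "hd (a @ [z]) = x"
      using p \<open>p = (a @ [z]) @ b\<close> by (cases a) auto
    ultimately have "a @ [z] \<in> paths E x z"
      by (simp add: paths_def)
    then show ?thesis by blast
  next
    case False
    then have "p @ [z] \<in> paths E x z"
      using p assms by (auto simp: paths_def successively_append_iff)
    then show ?thesis by blast
  qed
qed

lemma paths_nonempty_if_reachable:
  assumes "(x, y) \<in> {(u, v). {u, v} \<in> E}\<^sup>*"
  shows "paths E x y \<noteq> {}"
  using assms
proof (induction rule: rtrancl_induct)
  case base
  have "[x] \<in> paths E x x"
    by (simp add: paths_def)
  then show ?case by blast
next
  case (step y z)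
  then show ?case
    using paths_snoc_nonempty by fast
qed

lemma finite_connected_simple_graph_sun:
  assumes "g \<ge> 3"
  shows "finite_connected_simple_graph (sun_verts g d) (sun_edges g d)"
proof -
  define R where "R = {(u, v). {u, v} \<in> sun_edges g d}"
  have cyc: "(Cyc 0, Cyc i) \<in> R\<^sup>*" if "i < g" for i
    using that
  proof (induction i)
    case (Suc i)
    then have "(Cyc i, Cyc (Suc i)) \<in> R"
      by (auto simp: R_def sun_edges_def intro!: exI[of _ i])
    then show ?case
      using Suc by (meson Suc_lessD rtrancl.rtrancl_into_rtrancl)
  qed simp
  have leaf: "(Cyc 0, Leaf i j) \<in> R\<^sup>*" if "i < g" "j < d - 2" for i j
  proof -
    have "(Cyc i, Leaf i j) \<in> R"
      using that by (auto simp: R_def sun_edges_def)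
    then show ?thesis
      using cyc[OF that(1)] by (rule rtrancl_into_rtrancl[rotated])
  qed
  have reach: "(Cyc 0, x) \<in> R\<^sup>*" if "x \<in> sun_verts g d" for x
    using that cyc leaf by (auto simp: sun_verts_def)
  have "sym (R\<^sup>*)"
    by (intro sym_rtrancl) (auto simp: R_def sym_def insert_commute)
  then have "(x, y) \<in> R\<^sup>*" if "x \<in> sun_verts g d" "y \<in> sun_verts g d" for x y
    using reach[OF that(1)] reach[OF that(2)] by (meson rtrancl_trans symD)
  then have "paths (sun_edges g d) x y \<noteq> {}"
    if "x \<in> sun_verts g d" "y \<in> sun_verts g d" for x y
    using that paths_nonempty_if_reachable unfolding R_def by metis
  moreover have "finite (sun_verts g d)"
  proof -
    have "{Leaf i j | i j. i < g \<and> j < d - 2} = (\<lambda>(i, j). Leaf i j) ` ({..<g} \<times> {..<d - 2})"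
      by auto
    then show ?thesis by (simp add: sun_verts_def)
  qed
  moreover have "Cyc 0 \<in> sun_verts g d"
    using assms by (auto simp: sun_verts_def)
  moreover have "card e = 2 \<and> e \<subseteq> sun_verts g d" if "e \<in> sun_edges g d" for e
  proof -
    have "i \<noteq> Suc i mod g" if "i < g" for i
      using assms that by (cases "Suc i = g") auto
    then show ?thesis
      using that assms by (auto simp: sun_edges_def sun_verts_def card_insert_if dest: sym)
  qed
  ultimately show ?thesis
    unfolding finite_connected_simple_graph_def by blast
qed

lemma neighbours_Cyc:
  assumes "g \<ge> 3" "i < g"
  shows "neighbours (sun_edges g d) (Cyc i) =
    {Cyc (Suc i mod g), Cyc ((i + g - 1) mod g)} \<union> Leaf i ` {..<d - 2}"
proof -
  have pred: "Suc k mod g = i \<longleftrightarrow> k = (i + g - 1) mod g" if "k < g" for k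
    using assms that by (cases "Suc k = g"; cases "i = 0") (auto simp: mod_if)
  have "(i + g - 1) mod g < g"
    using assms by simp
  then show ?thesis
    using assms pred
    by (fastforce simp: neighbours_def sun_edges_def doubleton_eq_iff)
qed

lemma neighbours_Leaf:
  assumes "i < g" "j < d - 2"
  shows "neighbours (sun_edges g d) (Leaf i j) = {Cyc i}"
  using assms by (auto simp: neighbours_def sun_edges_def doubleton_eq_iff)

lemma degree_Cyc:
  assumes "g \<ge> 3" "d \<ge> 3" "i < g"
  shows "degree (sun_edges g d) (Cyc i) = d"
proof -
  have "Suc i mod g \<noteq> (i + g - 1) mod g"
    using assms by (cases "Suc i = g"; cases "i = 0") (auto simp: mod_if)
  moreover have "card (Leaf i ` {..<d - 2}) = d - 2"
    by (simp add: card_image inj_on_def)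
  ultimately show ?thesis
    unfolding degree_def neighbours_Cyc[OF assms(1,3)]
    using assms by (subst card_Un_disjoint) auto
qed

lemma degree_Leaf:
  assumes "i < g" "j < d - 2"
  shows "degree (sun_edges g d) (Leaf i j) = 1"
  using assms by (simp add: degree_def neighbours_Leaf)

end

theory Submission
  imports Defs
begin

text \<open>Let \<open>l\<close> be the distances between consecutive cycle vertices, \<open>n = d - 2\<close> and
  \<open>c = 4 - d \<kappa>\<close>. Computing the transport distances exactly, the Einstein equations force equal weights
  \<open>b\<^sub>i = (l\<^sub>i\<^sub>-\<^sub>1 + l\<^sub>i) / c\<close> on the leaf edges at a vertex, and after eliminating them they read
  \<open>c\<^sup>2 l\<^sub>i = n (l\<^sub>i\<^sub>-\<^sub>1 + 2 l\<^sub>i + l\<^sub>i\<^sub>+\<^sub>1) + c M\<^sub>i\<close>, where \<open>M\<^sub>i\<close> is the cost of the cheaper way to match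
  the two outer cycle neighbours. In every transport regime \<open>M\<^sub>i\<close> is a minimum of sums of distances,
  hence monotone and homogeneous in \<open>l\<close>. So this is a nonlinear Perron--Frobenius problem:
  evaluating the equation at the maximum and at the minimum of \<open>l\<close> gives the two opposite inequalities
  between \<open>c\<^sup>2\<close> and \<open>4 n + c M\<close>, with \<open>M\<close> the value for \<open>l = 1\<close>; equality then propagates the maximum
  around the cycle, so \<open>l\<close> is constant. Finally no cycle edge can be longer than the distance of its
  endpoints, as this distance would then be \<open>(g - 1) l\<close> or the edge weight.\<close>

section \<open>The path metric\<close>

lemma path_weight_snoc:
  assumes "p \<noteq> []"
  shows "path_weight w (p @ [z]) = path_weight w p + w {last p, z}"
proof -
  obtain n where n: "length p = Suc n"
    using assms by (cases p) auto
  then have "last p = p ! n"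
    using assms by (simp add: last_conv_nth)
  moreover have "(\<Sum>i<n. w {(p @ [z]) ! i, (p @ [z]) ! Suc i}) = (\<Sum>i<n. w {p ! i, p ! Suc i})"
    using n by (intro sum.cong) (auto simp: nth_append)
  ultimately show ?thesis
    using n by (simp add: path_weight_def nth_append)
qed

lemma path_weight_nonneg:
  assumes "successively (\<lambda>u v. {u, v} \<in> E) p" "positive_weighting E w"
  shows "0 \<le> path_weight w p"
  unfolding path_weight_def
proof (rule sum_nonneg)
  fix i assume "i \<in> {..<length p - 1}"
  then have "{p ! i, p ! Suc i} \<in> E"
    using assms(1) by (auto simp: successively_conv_nth)
  then show "0 \<le> w {p ! i, p ! Suc i}"
    using assms(2) by (auto simp: positive_weighting_def less_imp_le)
qed

text \<open>Edges have positive weight, so a path that already meets its next vertex can be cut off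
  there at no cost.\<close>

lemma path_weight_prefix_le:
  assumes "successively (\<lambda>u v. {u, v} \<in> E) (p @ q)" "positive_weighting E w"
  shows "path_weight w p \<le> path_weight w (p @ q)"
  using assms
proof (induction q rule: rev_induct)
  case (snoc z q)
  show ?case
  proof (cases "p @ q = []")
    case False
    from snoc.prems have "successively (\<lambda>u v. {u, v} \<in> E) ((p @ q) @ [z])"
      by simp
    then have "successively (\<lambda>u v. {u, v} \<in> E) (p @ q)" "{last (p @ q), z} \<in> E"
      using False by (auto simp del: append_assoc append_is_Nil_conv simp: successively_append_iff)
    then have "path_weight w p \<le> path_weight w (p @ q)" "0 < w {last (p @ q), z}"
      using snoc by (auto simp: positive_weighting_def)
    then show ?thesis
      using path_weight_snoc[OF False, of w z] by simp
  qed (simp add: path_weight_def)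
qed simp

text \<open>A telescoping sum along the path. Potentials are the source of the lower bounds on
  distances below.\<close>

lemma potential_le_path_weight:
  fixes f :: "'v \<Rightarrow> real"
  assumes "p \<noteq> []" "successively (\<lambda>u v. {u, v} \<in> E) p"
    and "\<And>u v. {u, v} \<in> E \<Longrightarrow> f v - f u \<le> w {u, v}"
  shows "f (last p) - f (hd p) \<le> path_weight w p"
  using assms(1,2)
proof (induction p rule: rev_nonempty_induct)
  case (single x)
  then show ?case by (simp add: path_weight_def)
next
  case (snoc z p)
  then have "successively (\<lambda>u v. {u, v} \<in> E) p" "{last p, z} \<in> E"
    by (auto simp: successively_append_iff)
  then have "f (last p) - f (hd p) \<le> path_weight w p" "f z - f (last p) \<le> w {last p, z}"
    using snoc.IH assms(3) by auto
  then show ?case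
    using path_weight_snoc[of p w z] snoc.hyps by simp
qed

locale weighted_graph =
  fixes V :: "'v set" and E :: "'v set set" and w :: "'v set \<Rightarrow> real"
  assumes graph: "finite_connected_simple_graph V E"
    and pos: "positive_weighting E w"
begin

abbreviation D :: "'v \<Rightarrow> 'v \<Rightarrow> real" where
  "D \<equiv> wdist E w"

lemma edge_verts: "{u, v} \<in> E \<Longrightarrow> u \<in> V \<and> v \<in> V \<and> u \<noteq> v"
  using graph by (fastforce simp: finite_connected_simple_graph_def)

lemma paths_nonempty: "u \<in> V \<Longrightarrow> v \<in> V \<Longrightarrow> paths E u v \<noteq> {}"
  using graph by (simp add: finite_connected_simple_graph_def)

lemma wdist_le_path_weight: "p \<in> paths E u v \<Longrightarrow> D u v \<le> path_weight w p"
  unfolding wdist_def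
  by (rule cINF_lower)
    (auto intro!: bdd_belowI2[where m = 0] path_weight_nonneg[where E = E] pos simp: paths_def)

lemma potential_le_wdist:
  assumes "u \<in> V" "v \<in> V" "\<And>a b. {a, b} \<in> E \<Longrightarrow> f b - f a \<le> w {a, b}"
  shows "f v - f u \<le> D u v"
  unfolding wdist_def
proof (rule cINF_greatest[OF paths_nonempty[OF assms(1,2)]])
  fix p assume "p \<in> paths E u v"
  then show "f v - f u \<le> path_weight w p"
    using potential_le_path_weight[of p E f w] assms(3) by (auto simp: paths_def)
qed

lemma wdist_nonneg: "u \<in> V \<Longrightarrow> v \<in> V \<Longrightarrow> 0 \<le> D u v"
  using potential_le_wdist[of u v "\<lambda>_. 0"] pos by (simp add: positive_weighting_def less_imp_le)

lemma wdist_self [simp]: "u \<in> V \<Longrightarrow> D u u = 0"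
  using wdist_le_path_weight[of "[u]" u u] wdist_nonneg[of u u]
  by (simp add: paths_def path_weight_def)

text \<open>\<open>paths\<close> contains only lists without repetition, so a path to
  \<open>v\<close> through \<open>z\<close> cannot be extended by \<open>z\<close>; it is cut at
  \<open>z\<close> instead.\<close>

lemma wdist_edge_step:
  assumes "u \<in> V" "{v, z} \<in> E"
  shows "D u z \<le> D u v + w {v, z}"
proof -
  have "D u z - w {v, z} \<le> D u v"
    unfolding wdist_def[of E w u v]
  proof (rule cINF_greatest)
    show "paths E u v \<noteq> {}"
      using assms edge_verts paths_nonempty by auto
  next
    fix p assume p: "p \<in> paths E u v"
    then have p_nonempty: "p \<noteq> []" and p_edges: "successively (\<lambda>u v. {u, v} \<in> E) p"
      and p_last: "last p = v"
      by (auto simp: paths_def)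
    show "D u z - w {v, z} \<le> path_weight w p"
    proof (cases "z \<in> set p")
      case True
      then obtain a b where ab: "p = (a @ [z]) @ b"
        by (metis split_list append.assoc append_Cons append_Nil)
      have "successively (\<lambda>u v. {u, v} \<in> E) (a @ [z])"
        using p_edges unfolding ab successively_append_iff[of _ "a @ [z]" b] by blast
      then have "a @ [z] \<in> paths E u z"
        using p ab unfolding paths_def by (cases a) auto
      then have "D u z \<le> path_weight w (a @ [z])"
        by (rule wdist_le_path_weight)
      also have "\<dots> \<le> path_weight w p"
        using path_weight_prefix_le[of E "a @ [z]" b w] p_edges pos ab by simp
      finally show ?thesis
        using assms(2) pos by (simp add: positive_weighting_def)
          (smt (verit, best))
    next
      case False
      then have "p @ [z] \<in> paths E u z"
        using p assms(2) by (auto simp: paths_def successively_append_iff)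
      then show ?thesis
        using wdist_le_path_weight path_weight_snoc[OF p_nonempty, of w z] p_last by fastforce
    qed
  qed
  then show ?thesis by simp
qed

lemma wdist_le_weight: "{u, v} \<in> E \<Longrightarrow> D u v \<le> w {u, v}"
  using wdist_edge_step[of u u v] edge_verts by fastforce

text \<open>By \<open>wdist_edge_step\<close> the function \<open>D u\<close> is itself a potential,
  which replaces the concatenation of paths.\<close>

lemma wdist_triangle:
  assumes "u \<in> V" "v \<in> V" "z \<in> V"
  shows "D u z \<le> D u v + D v z"
proof -
  have "D u z - D u v \<le> D v z"
    using assms wdist_edge_step[OF assms(1)] by (intro potential_le_wdist) (auto simp: algebra_simps)
  then show ?thesis by simp
qed

text \<open>Symmetry needs no reversal of paths: \<open>- D u\<close> is a potential, and it bounds \<open>D v u\<close>.\<close>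

lemma wdist_commute:
  assumes "u \<in> V" "v \<in> V"
  shows "D u v = D v u"
proof -
  have le: "D a b \<le> D b a" if "a \<in> V" "b \<in> V" for a b
  proof -
    have "- D a a - - D a b \<le> D b a"
    proof (rule potential_le_wdist[of b a "\<lambda>z. - D a z"])
      fix u v assume "{u, v} \<in> E"
      then show "- D a v - - D a u \<le> w {u, v}"
        using wdist_edge_step[of a v u] that by (simp add: insert_commute)
    qed (use that in auto)
    then show ?thesis using that by simp
  qed
  then show ?thesis using assms by (simp add: antisym)
qed

end

section \<open>Transport distances and curvature\<close>

text \<open>Swapping components is a bijection between the two sets of couplings. The cost is
  symmetric only on the supports because \<open>wdist_commute\<close> holds only on
  \<open>V\<close>.\<close>

lemma wasserstein_commute:
  assumes "\<And>x y. x \<in> set_pmf p \<Longrightarrow> y \<in> set_pmf q \<Longrightarrow> c x y = c y x"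
  shows "wasserstein c p q = wasserstein c q p"
proof -
  define K where "K p q = {m. map_pmf fst m = p \<and> map_pmf snd m = q}" for p q :: "'a pmf"
  have sub: "map_pmf prod.swap ` K p q \<subseteq> K q p" for p q
    by (auto simp: K_def pmf.map_comp comp_def)
  have "K q p = map_pmf prod.swap ` map_pmf prod.swap ` K q p"
    by (simp add: image_image pmf.map_comp)
  with sub have image: "K q p = map_pmf prod.swap ` K p q"
    by (metis image_mono subset_antisym)
  have cost: "measure_pmf.expectation (map_pmf prod.swap m) (\<lambda>(x, y). c x y) =
      measure_pmf.expectation m (\<lambda>(x, y). c x y)" if "m \<in> K p q" for m
  proof -
    have "c (snd z) (fst z) = c (fst z) (snd z)" if "z \<in> set_pmf m" for z
      using that \<open>m \<in> K p q\<close> assms[of "fst z" "snd z"] by (force simp: K_def)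
    then show ?thesis
      unfolding integral_map_pmf
      by (intro integral_cong_AE) (auto simp: AE_measure_pmf_iff case_prod_beta)
  qed
  show ?thesis
    unfolding wasserstein_def K_def[symmetric] image image_image using cost by simp
qed

text \<open>Kantorovich duality in the easy direction: a coupling, given as weighted pairs \<open>(u t, v t)\<close>,
  and a potential of the same value certify each other's optimality.\<close>

lemma wasserstein_eqI:
  fixes f :: "'v \<Rightarrow> real" and wt :: "'t \<Rightarrow> real"
  assumes T: "finite T" "\<And>t. t \<in> T \<Longrightarrow> 0 \<le> wt t"
    and fin: "finite (set_pmf p)" "finite (set_pmf q)"
    and marg: "\<And>h :: 'v \<Rightarrow> real. (\<Sum>t\<in>T. wt t * h (u t)) = measure_pmf.expectation p h"
      "\<And>h :: 'v \<Rightarrow> real. (\<Sum>t\<in>T. wt t * h (v t)) = measure_pmf.expectation q h"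
    and lip: "\<And>x y. x \<in> set_pmf p \<Longrightarrow> y \<in> set_pmf q \<Longrightarrow> f x - f y \<le> c x y"
    and dual: "measure_pmf.expectation p f - measure_pmf.expectation q f = S"
    and primal: "(\<Sum>t\<in>T. wt t * c (u t) (v t)) = S"
  shows "wasserstein c p q = S"
proof -
  define K where "K = {m. map_pmf fst m = p \<and> map_pmf snd m = q}"
  have lower: "S \<le> measure_pmf.expectation m (\<lambda>(x, y). c x y)" if "m \<in> K" for m
  proof -
    have m: "map_pmf fst m = p" "map_pmf snd m = q"
      using that by (auto simp: K_def)
    have "set_pmf p = fst ` set_pmf m" "set_pmf q = snd ` set_pmf m"
      by (simp_all flip: m)
    then have set_m: "set_pmf m \<subseteq> set_pmf p \<times> set_pmf q"
      by force
    then have fin_m: "finite (set_pmf m)"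
      using fin finite_subset by blast
    have "S = measure_pmf.expectation m (\<lambda>z. f (fst z)) - measure_pmf.expectation m (\<lambda>z. f (snd z))"
      unfolding dual[symmetric] m[symmetric] by simp
    also have "\<dots> = measure_pmf.expectation m (\<lambda>z. f (fst z) - f (snd z))"
      by (rule Bochner_Integration.integral_diff[symmetric])
        (auto intro: integrable_measure_pmf_finite fin_m)
    also have "\<dots> \<le> measure_pmf.expectation m (\<lambda>(x, y). c x y)"
      using set_m lip
      by (intro integral_mono_AE integrable_measure_pmf_finite fin_m)
        (auto simp: AE_measure_pmf_iff case_prod_beta)
    finally show ?thesis .
  qed
  \<comment> \<open>\<open>embed_pmf\<close> expects a mass function on the whole type, hence the
    extension by 0; the marginal identity for the constant 1 supplies total mass 1.\<close>
  define wt' where "wt' t = (if t \<in> T then wt t else 0)" for t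
  have wt'_nonneg: "0 \<le> wt' t" for t
    using T by (simp add: wt'_def)
  have total: "(\<integral>\<^sup>+ t. ennreal (wt' t) \<partial>count_space UNIV) = 1"
  proof -
    have "(\<integral>\<^sup>+ t. ennreal (wt' t) \<partial>count_space UNIV) = (\<Sum>t\<in>T. ennreal (wt' t))"
      by (rule nn_integral_count_space'[OF T(1)]) (auto simp: wt'_def)
    also have "\<dots> = ennreal (\<Sum>t\<in>T. wt t)"
      using T by (subst sum_ennreal) (auto simp: wt'_def)
    also have "(\<Sum>t\<in>T. wt t) = 1"
      using marg(1)[of "\<lambda>_. 1"] by simp
    finally show ?thesis by simp
  qed
  define m where "m = embed_pmf wt'"
  have pmf_m: "pmf m t = wt' t" for t
    unfolding m_def by (rule pmf_embed_pmf[OF wt'_nonneg total])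
  have set_m: "set_pmf m \<subseteq> T"
    by (auto simp: set_pmf_iff pmf_m wt'_def split: if_splits)
  have E_m: "measure_pmf.expectation m h = (\<Sum>t\<in>T. wt t * h t)" for h :: "'t \<Rightarrow> real"
    using set_m by (subst integral_measure_pmf_real[OF T(1)]) (auto simp: pmf_m wt'_def mult.commute)
  have map_m: "map_pmf u m = r"
    if "\<And>h :: 'v \<Rightarrow> real. (\<Sum>t\<in>T. wt t * h (u t)) = measure_pmf.expectation r h" for u r
  proof (rule pmf_eqI)
    fix z
    have "pmf (map_pmf u m) z = measure_pmf.expectation (map_pmf u m) (indicator {z})"
      by (simp add: measure_pmf_single)
    also have "\<dots> = measure_pmf.expectation r (indicator {z})"
      by (simp add: E_m that del: Bochner_Integration.integral_indicator)
    finally show "pmf (map_pmf u m) z = pmf r z"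
      by (simp add: measure_pmf_single)
  qed
  have coupling: "map_pmf (\<lambda>t. (u t, v t)) m \<in> K"
    using map_m[OF marg(1)] map_m[OF marg(2)] by (simp add: K_def pmf.map_comp comp_def)
  have "wasserstein c p q \<le> S"
    unfolding wasserstein_def K_def[symmetric]
    using cINF_lower[OF bdd_belowI2[of K S] coupling, of "\<lambda>m. measure_pmf.expectation m (\<lambda>(x, y). c x y)"]
      lower primal by (simp add: E_m)
  moreover have "S \<le> wasserstein c p q"
    unfolding wasserstein_def K_def[symmetric] using coupling lower by (intro cINF_greatest) auto
  ultimately show ?thesis by simp
qed

lemma set_lazy_step:
  assumes "finite (neighbours E x)" "neighbours E x \<noteq> {}"
  shows "set_pmf (lazy_step E \<alpha> x) \<subseteq> insert x (neighbours E x)"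
  using set_pmf_of_set[OF assms(2,1)] by (auto simp: lazy_step_def split: if_splits)

lemma expectation_lazy_step:
  fixes h :: "'v \<Rightarrow> real"
  assumes "0 \<le> \<alpha>" "\<alpha> \<le> 1" "finite (neighbours E x)" "neighbours E x \<noteq> {}" "{x} \<notin> E"
  shows "measure_pmf.expectation (lazy_step E \<alpha> x) h =
    \<alpha> * h x + (1 - \<alpha>) / real (degree E x) * (\<Sum>z\<in>neighbours E x. h z)"
proof -
  have "x \<notin> neighbours E x"
    using assms by (simp add: neighbours_def)
  moreover have "measure_pmf.expectation (lazy_step E \<alpha> x) h =
      (\<Sum>z\<in>insert x (neighbours E x). h z * pmf (lazy_step E \<alpha> x) z)"
    using assms set_lazy_step[OF assms(3,4)] by (intro integral_measure_pmf_real) auto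
  moreover have "(\<Sum>z\<in>neighbours E x. h z * pmf (lazy_step E \<alpha> x) z) =
      (\<Sum>z\<in>neighbours E x. (1 - \<alpha>) / real (degree E x) * h z)"
    using assms \<open>x \<notin> neighbours E x\<close> by (intro sum.cong) (auto simp: pmf_lazy_step)
  ultimately show ?thesis
    using assms by (simp add: pmf_lazy_step sum_distrib_left)
qed

text \<open>\<open>discrete_Einstein\<close> ranges over ordered pairs, so every edge occurs in both
  orientations; this reduces them to one.\<close>

lemma (in weighted_graph) has_lly_curvature_commute:
  assumes "{x, y} \<in> E"
  shows "has_lly_curvature E w x y \<kappa> \<longleftrightarrow> has_lly_curvature E w y x \<kappa>"
proof -
  have supp: "set_pmf (lazy_step E \<alpha> z) \<subseteq> V" if "z \<in> {x, y}" for \<alpha> z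
  proof -
    have "{y, x} \<in> E"
      using assms by (simp add: insert_commute)
    then have nb: "neighbours E z \<subseteq> V" "neighbours E z \<noteq> {}" "z \<in> V"
      using that assms edge_verts unfolding neighbours_def by blast+
    moreover have "finite (neighbours E z)"
      using nb(1) graph finite_subset by (auto simp: finite_connected_simple_graph_def)
    ultimately show ?thesis
      using set_lazy_step[of E z \<alpha>] by blast
  qed
  have "wasserstein D (lazy_step E \<alpha> x) (lazy_step E \<alpha> y) =
      wasserstein D (lazy_step E \<alpha> y) (lazy_step E \<alpha> x)" for \<alpha>
    using supp[of x \<alpha>] supp[of y \<alpha>] by (intro wasserstein_commute wdist_commute) auto
  moreover have "D x y = D y x"
    using assms edge_verts wdist_commute by blast
  ultimately show ?thesis
    by (simp add: has_lly_curvature_def lly_kappa_def)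
qed

text \<open>The transport distance is affine in \<open>\<alpha>\<close> on an interval ending at 1,
  so the quotient is constant there and the limit is that constant.\<close>

lemma has_lly_curvature_iff:
  fixes n :: nat and \<kappa> :: real
  assumes "wdist E w x y > 0" "n > 0"
    and "\<And>\<alpha>. 1/2 < \<alpha> \<Longrightarrow> \<alpha> < 1 \<Longrightarrow>
      wasserstein (wdist E w) (lazy_step E \<alpha> x) (lazy_step E \<alpha> y) = wdist E w x y - (1 - \<alpha>) / n * K"
  shows "has_lly_curvature E w x y \<kappa> \<longleftrightarrow> n * \<kappa> * wdist E w x y = K"
proof -
  have "eventually (\<lambda>\<alpha>. \<alpha> \<in> {1/2<..<1::real}) (at_left 1)"
    by (rule eventually_at_left_real) simp
  then have "eventually (\<lambda>\<alpha>. lly_kappa E w \<alpha> x y / (1 - \<alpha>) = K / (n * wdist E w x y)) (at_left 1)"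
  proof eventually_elim
    case (elim \<alpha>)
    then have "1 - \<alpha> \<noteq> 0" "wasserstein (wdist E w) (lazy_step E \<alpha> x) (lazy_step E \<alpha> y) =
        wdist E w x y - (1 - \<alpha>) / n * K"
      using assms(3)[of \<alpha>] by simp_all
    moreover have "(1 - (D - e / n * K) / D) / e = K / (n * D)" if "D > 0" "e \<noteq> 0" for D e :: real
      using that assms(2) by (simp add: field_simps)
    ultimately show ?case
      using assms(1) by (simp add: lly_kappa_def)
  qed
  then have "((\<lambda>\<alpha>. lly_kappa E w \<alpha> x y / (1 - \<alpha>)) \<longlongrightarrow> K / (n * wdist E w x y)) (at_left 1)"
    by (rule tendsto_eventually)
  then have "has_lly_curvature E w x y \<kappa> \<longleftrightarrow> \<kappa> = K / (n * wdist E w x y)"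
    unfolding has_lly_curvature_def
    by (auto intro: tendsto_unique[OF trivial_limit_at_left_real])
  then show ?thesis
    using assms(1,2) by (simp add: field_simps)
qed

section \<open>Distances in a weighted sun\<close>

text \<open>The distance of two vertices \<open>r\<close> steps apart on the cycle with unit
  weights, for \<open>r \<le> g\<close>; at \<open>r = g\<close> the walk has closed up.\<close>

definition cycle_hop :: "nat \<Rightarrow> nat \<Rightarrow> real" where
  "cycle_hop g r = real (min r (g - r))"

locale weighted_sun =
  fixes g d :: nat and w :: "sun_vertex set \<Rightarrow> real"
  assumes g: "g \<ge> 3" and d: "d \<ge> 3"
    and pos_sun: "positive_weighting (sun_edges g d) w"
begin

abbreviation "V \<equiv> sun_verts g d"
abbreviation "E \<equiv> sun_edges g d"

sublocale weighted_graph V E w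
  using g pos_sun by unfold_locales (rule finite_connected_simple_graph_sun)

section \<open>Notation around the cycle\<close>

definition n :: nat where "n = d - 2"

text \<open>Reducing the index inside \<open>C\<close> and \<open>L\<close> lets the closing edge of
  the cycle be treated like all others.\<close>

definition C :: "nat \<Rightarrow> sun_vertex" where "C k = Cyc (k mod g)"
definition L :: "nat \<Rightarrow> nat \<Rightarrow> sun_vertex" where "L k j = Leaf (k mod g) j"
definition a :: "nat \<Rightarrow> real" where "a k = w {C k, C (Suc k)}"
definition b :: "nat \<Rightarrow> nat \<Rightarrow> real" where "b k j = w {C k, L k j}"
definition B :: "nat \<Rightarrow> real" where "B k = (\<Sum>j<n. b k j)"
text \<open>Kept apart from the weight \<open>a\<close>, since an edge may be heavier than a detour
  and the curvature sees only distances.\<close>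

definition l :: "nat \<Rightarrow> real" where "l k = D (C k) (C (Suc k))"

text \<open>The two ways to carry unit masses from \<open>C k\<close> and \<open>C (Suc k)\<close>
  to \<open>C (k + 2)\<close> and \<open>C (k + 3)\<close>: the first sends \<open>C k\<close> to
  \<open>C (k + 3)\<close>, the second to \<open>C (k + 2)\<close>.\<close>

definition M :: "nat \<Rightarrow> real" where
  "M k = min (l (Suc k) + D (C k) (C (k + 3))) (D (C k) (C (k + 2)) + D (C (Suc k)) (C (k + 3)))"

lemma d_eq: "real d = n + 2"
  using d by (simp add: n_def of_nat_diff)

lemma n_pos: "n > 0"
  using d by (simp add: n_def)

lemma mod_lt [simp]: "k mod g < g"
  using g by simp

lemma C_in [simp]: "C k \<in> V"
  by (auto simp: C_def sun_verts_def)

lemma L_in [simp]: "j < n \<Longrightarrow> L k j \<in> V"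
  by (auto simp: L_def sun_verts_def n_def)

lemma C_neq_L [simp]: "C k \<noteq> L m j" "L m j \<noteq> C k"
  by (auto simp: C_def L_def)

lemma L_eq [simp]: "L k i = L m j \<longleftrightarrow> k mod g = m mod g \<and> i = j"
  by (auto simp: L_def)

lemma C_cong: "k mod g = m mod g \<Longrightarrow> C k = C m"
  by (simp add: C_def)

lemma index_neq:
  assumes "0 < m" "m < g"
  shows "k mod g \<noteq> (k + m) mod g"
proof
  assume "k mod g = (k + m) mod g"
  then have "g dvd k + m - k"
    by (intro mod_eq_dvd_iff_nat[THEN iffD1]) (rule le_add1, rule sym)
  then show False
    using dvd_imp_le[of g m] assms by simp
qed

lemma edge_cyc: "{C k, C (Suc k)} \<in> E"
proof -
  have "{C k, C (Suc k)} = {Cyc (k mod g), Cyc (Suc (k mod g) mod g)}"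
    by (simp add: C_def mod_Suc_eq)
  then show ?thesis
    using mod_lt[of k] unfolding sun_edges_def by blast
qed

lemma edge_leaf: "j < n \<Longrightarrow> {C k, L k j} \<in> E"
  using mod_lt[of k] unfolding sun_edges_def C_def L_def n_def by blast

lemma edge_cases:
  assumes "e \<in> E"
  obtains k where "k < g" "e = {C k, C (Suc k)}" | k j where "k < g" "j < n" "e = {C k, L k j}"
proof -
  have C: "C k = Cyc k" "L k j = Leaf k j" "C (Suc k) = Cyc (Suc k mod g)" if "k < g" for k j
    using that by (auto simp: C_def L_def)
  from assms consider k where "k < g" "e = {Cyc k, Cyc (Suc k mod g)}"
    | k j where "k < g" "j < n" "e = {Cyc k, Leaf k j}"
    unfolding sun_edges_def n_def by blast
  then show thesis
  proof cases
    case (1 k)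
    then show ?thesis using that(1)[of k] C by simp
  next
    case (2 k j)
    then show ?thesis using that(2)[of k j] C by simp
  qed
qed

text \<open>The index shift \<open>k = Suc k'\<close> makes all neighbours expressible without subtraction.\<close>

lemma exists_index: "\<exists>k'. k mod g = Suc k' mod g"
proof -
  have "Suc (k + (g - 1)) = k + g"
    using g by simp
  then have "k mod g = Suc (k + (g - 1)) mod g"
    by (metis mod_add_self2)
  then show ?thesis ..
qed

lemma neighbours_C: "neighbours E (C (Suc k)) = {C (k + 2), C k} \<union> L (Suc k) ` {..<n}"
proof -
  have "(Suc k mod g + g - 1) mod g = k mod g"
  proof -
    have "Suc k mod g + g - 1 = Suc k mod g + (g - 1)"
      using g by simp
    also have "(Suc k mod g + (g - 1)) mod g = (Suc k + (g - 1)) mod g"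
      by (rule mod_add_left_eq)
    also have "Suc k + (g - 1) = k + g"
      using g by simp
    finally show ?thesis by simp
  qed
  moreover have "Suc (Suc k mod g) mod g = (k + 2) mod g"
    using mod_Suc_eq[of "Suc k" g] by simp
  moreover have "L (Suc k) = Leaf (Suc k mod g)"
    by (simp add: L_def fun_eq_iff)
  ultimately show ?thesis
    using neighbours_Cyc[OF g mod_lt[of "Suc k"], of d] unfolding C_def n_def by (simp only:)
qed

lemma C_neq_C_add_2: "C k \<noteq> C (k + 2)"
  using index_neq[of 2 k] g by (auto simp: C_def)

section \<open>Expectations and supports of the one-step measures\<close>

lemma expectation_C:
  fixes h :: "sun_vertex \<Rightarrow> real"
  assumes "0 \<le> \<alpha>" "\<alpha> \<le> 1"
  shows "measure_pmf.expectation (lazy_step E \<alpha> (C (Suc k))) h =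
    \<alpha> * h (C (Suc k)) + (1 - \<alpha>) / d * (h (C (k + 2)) + h (C k) + (\<Sum>j<n. h (L (Suc k) j)))"
proof -
  have "(\<Sum>z\<in>neighbours E (C (Suc k)). h z) =
      (\<Sum>z\<in>{C (k + 2), C k}. h z) + (\<Sum>z\<in>L (Suc k) ` {..<n}. h z)"
    unfolding neighbours_C by (rule sum.union_disjoint) auto
  also have "(\<Sum>z\<in>L (Suc k) ` {..<n}. h z) = (\<Sum>j<n. h (L (Suc k) j))"
    by (subst sum.reindex) (auto simp: inj_on_def)
  finally have sum: "(\<Sum>z\<in>neighbours E (C (Suc k)). h z) =
      h (C (k + 2)) + h (C k) + (\<Sum>j<n. h (L (Suc k) j))"
    using C_neq_C_add_2[of k] by simp
  have deg: "degree E (C (Suc k)) = d"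
    using degree_Cyc[OF g d mod_lt] by (simp add: C_def)
  have "{C (Suc k)} \<notin> E"
    using edge_verts[of "C (Suc k)" "C (Suc k)"] by auto
  moreover have "finite (neighbours E (C (Suc k)))" "neighbours E (C (Suc k)) \<noteq> {}"
    by (auto simp: neighbours_C)
  ultimately show ?thesis
    using expectation_lazy_step[OF assms, of E "C (Suc k)" h] unfolding sum deg by simp
qed

lemma finite_lazy_step_C: "finite (set_pmf (lazy_step E \<alpha> (C (Suc k))))"
  and set_lazy_step_C: "set_pmf (lazy_step E \<alpha> (C (Suc k))) \<subseteq> V"
proof -
  have sub: "set_pmf (lazy_step E \<alpha> (C (Suc k))) \<subseteq> insert (C (Suc k)) (neighbours E (C (Suc k)))"
    by (rule set_lazy_step) (auto simp: neighbours_C)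
  also have "\<dots> \<subseteq> V"
    by (auto simp: neighbours_C)
  finally show "set_pmf (lazy_step E \<alpha> (C (Suc k))) \<subseteq> V" .
  show "finite (set_pmf (lazy_step E \<alpha> (C (Suc k))))"
    by (rule finite_subset[OF sub]) (auto simp: neighbours_C)
qed

lemma neighbours_L: "j < n \<Longrightarrow> neighbours E (L k j) = {C k}"
  using neighbours_Leaf[OF mod_lt] by (simp add: C_def L_def n_def)

lemma expectation_L:
  fixes h :: "sun_vertex \<Rightarrow> real"
  assumes "0 \<le> \<alpha>" "\<alpha> \<le> 1" "j < n"
  shows "measure_pmf.expectation (lazy_step E \<alpha> (L k j)) h = \<alpha> * h (L k j) + (1 - \<alpha>) * h (C k)"
proof -
  have "{L k j} \<notin> E"
    using edge_verts[of "L k j" "L k j"] by auto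
  moreover have "degree E (L k j) = 1"
    using degree_Leaf[OF mod_lt] assms by (simp add: L_def n_def)
  ultimately show ?thesis
    using assms by (subst expectation_lazy_step) (auto simp: neighbours_L)
qed

lemma finite_lazy_step_L: "j < n \<Longrightarrow> finite (set_pmf (lazy_step E \<alpha> (L k j)))"
  and set_lazy_step_L: "j < n \<Longrightarrow> set_pmf (lazy_step E \<alpha> (L k j)) \<subseteq> V"
proof -
  assume j: "j < n"
  have sub: "set_pmf (lazy_step E \<alpha> (L k j)) \<subseteq> insert (L k j) (neighbours E (L k j))"
    using j by (intro set_lazy_step) (auto simp: neighbours_L)
  also have "\<dots> \<subseteq> V"
    using j by (auto simp: neighbours_L)
  finally show "set_pmf (lazy_step E \<alpha> (L k j)) \<subseteq> V" .
  show "finite (set_pmf (lazy_step E \<alpha> (L k j)))"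
    using j by (intro finite_subset[OF sub]) (auto simp: neighbours_L)
qed

section \<open>Distances from leaves and along the cycle\<close>

lemma a_pos: "a k > 0"
  using pos edge_cyc by (simp add: positive_weighting_def a_def)

lemma b_pos: "j < n \<Longrightarrow> b k j > 0"
  using pos edge_leaf by (simp add: positive_weighting_def b_def)

text \<open>A leaf can be left only through its cycle vertex. The upper bound is the triangle
  inequality, the lower one comes from a potential.\<close>

lemma wdist_leaf:
  assumes "j < n" "z \<in> V" "z \<noteq> L k j"
  shows "D (L k j) z = b k j + D (C k) z"
proof (rule antisym)
  have "D (L k j) (C k) \<le> b k j"
    using wdist_le_weight[of "L k j" "C k"] edge_leaf[OF assms(1), of k]
    by (simp add: insert_commute[of "L k j"] b_def)
  then show "D (L k j) z \<le> b k j + D (C k) z"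
    using wdist_triangle[of "L k j" "C k" z] assms by simp
next
  have nb: "v = C k" if "{L k j, v} \<in> E" for v
    using that neighbours_L[OF assms(1), of k] unfolding neighbours_def by blast
  \<comment> \<open>The distance from \<open>C k\<close>, except that at the leaf it is negated, so
    that the potential rises by exactly \<open>b k j\<close> from the leaf to
    \<open>C k\<close>.\<close>
  define f where "f v = (if v = L k j then - b k j else D (C k) v)" for v
  have "f z - f (L k j) \<le> D (L k j) z"
  proof (rule potential_le_wdist)
    fix u v assume uv: "{u, v} \<in> E"
    show "f v - f u \<le> w {u, v}"
    proof (cases "L k j \<in> {u, v}")
      case True
      then consider "u = L k j" "v = C k" | "u = C k" "v = L k j"
        using uv nb[of v] nb[of u] by (metis insert_commute insert_iff singletonD)
      then show ?thesis
        using b_pos[OF assms(1), of k]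
        by cases (simp_all add: f_def b_def insert_commute[of "L k j"])
    next
      case False
      then have "u \<noteq> L k j" "v \<noteq> L k j"
        by auto
      then show ?thesis
        using wdist_edge_step[OF C_in uv, of k] by (simp add: f_def)
    qed
  qed (use assms in auto)
  then show "b k j + D (C k) z \<le> D (L k j) z"
    using assms by (simp add: f_def)
qed

lemma wdist_leaf_C: "j < n \<Longrightarrow> D (L k j) (C k) = b k j"
  using wdist_leaf[of j "C k" k] by simp

lemma wdist_C_leaf: "j < n \<Longrightarrow> D (C k) (L k j) = b k j"
  using wdist_leaf_C[of j k] wdist_commute by simp

text \<open>A potential given by the offset from \<open>i\<close>, extended to each leaf by the
  value at its cycle vertex. The modulus in the assumption also covers the closing edge, from offset
  \<open>g - 1\<close> back to 0.\<close>

lemma potential_le_wdist_cycle: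
  fixes \<psi> :: "nat \<Rightarrow> real"
  assumes "\<And>k. k < g \<Longrightarrow> \<bar>\<psi> (Suc k mod g) - \<psi> k\<bar> \<le> a (i + k)" and "r < g"
  shows "\<psi> r - \<psi> 0 \<le> D (C i) (C (i + r))"
proof -
  \<comment> \<open>The offset of \<open>k\<close> from \<open>i\<close> modulo \<open>g\<close>;
    adding \<open>g - i mod g\<close> avoids truncated subtraction of \<open>i\<close>.\<close>
  define off where "off k = (k + (g - i mod g)) mod g" for k
  define idx where "idx v = (case v of Cyc k \<Rightarrow> k | Leaf k j \<Rightarrow> k)" for v
  define f where "f v = \<psi> (off (idx v))" for v
  have off_shift: "off (i + k) = k mod g" for k
  proof -
    have "i = g * (i div g) + i mod g"
      by simp
    then have "i + k + (g - i mod g) = k + g * Suc (i div g)"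
      using mod_lt[of i] unfolding mult_Suc_right by linarith
    then show ?thesis
      unfolding off_def by (metis mod_mult_self2)
  qed
  have off_mod: "off (k mod g) = off k" for k
    unfolding off_def by (simp add: mod_add_left_eq)
  have f_C: "f (C (i + k)) = \<psi> (k mod g)" for k
    by (simp add: f_def idx_def C_def off_mod off_shift)
  have f_L: "f (L k j) = f (C k)" for k j
    by (simp add: f_def idx_def C_def L_def)
  have shift: "k mod g = (i + off k) mod g" for k
  proof -
    have "(i + off k) mod g = (i + (k + (g - i mod g))) mod g"
      unfolding off_def by (simp add: mod_add_right_eq)
    also have "\<dots> = (i mod g + (k + (g - i mod g))) mod g"
      by (simp add: mod_add_left_eq)
    also have "i mod g + (k + (g - i mod g)) = k + g"
      using mod_lt[of i] by linarith
    finally show ?thesis by simp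
  qed
  have step: "\<bar>f (C (Suc k)) - f (C k)\<bar> \<le> w {C k, C (Suc k)}" for k
  proof -
    have Ck: "C k = C (i + off k)"
      by (rule C_cong) (rule shift)
    have CSk: "C (Suc k) = C (i + Suc (off k))"
      using shift[of k] by (intro C_cong) (metis add_Suc_right mod_Suc_eq)
    have "off k < g"
      by (simp add: off_def)
    then show ?thesis
      using assms(1)[of "off k"] unfolding Ck CSk f_C a_def by simp
  qed
  have "f (C (i + r)) - f (C i) \<le> D (C i) (C (i + r))"
  proof (rule potential_le_wdist)
    fix u v assume "{u, v} \<in> E"
    then show "f v - f u \<le> w {u, v}"
    proof (cases rule: edge_cases)
      case (1 k)
      then have "\<bar>f v - f u\<bar> \<le> w {u, v}"
        using step[of k] by (auto simp: doubleton_eq_iff insert_commute abs_minus_commute)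
      then show ?thesis by simp
    next
      case (2 k j)
      then have "f v = f u"
        by (auto simp: doubleton_eq_iff f_L)
      then show ?thesis
        using \<open>{u, v} \<in> E\<close> pos by (simp add: positive_weighting_def less_imp_le)
    qed
  qed auto
  then show ?thesis
    using f_C[of r] f_C[of 0] assms(2) by simp
qed

abbreviation hop :: "nat \<Rightarrow> real" where "hop \<equiv> cycle_hop g"

text \<open>The potential is \<open>m * hop\<close>, whose steps have size at most \<open>m\<close>,
  also across the closing edge.\<close>

lemma hop_le_wdist:
  assumes "\<And>k. m \<le> a k" "0 \<le> m" "r \<le> g"
  shows "m * hop r \<le> D (C i) (C (i + r))"
proof (cases "r = g")
  \<comment> \<open>\<open>potential_le_wdist_cycle\<close> covers offsets below \<open>g\<close>;
    \<open>r = g\<close> occurs for the triangle, where \<open>C (k + 3) = C k\<close>.\<close>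
  case True
  then show ?thesis by (simp add: cycle_hop_def wdist_nonneg)
next
  case False
  have "m * hop r - m * hop 0 \<le> D (C i) (C (i + r))"
  proof (rule potential_le_wdist_cycle)
    fix k assume "k < g"
    then have "\<bar>hop (Suc k mod g) - hop k\<bar> \<le> 1"
      by (cases "Suc k = g") (auto simp: cycle_hop_def min_def of_nat_diff)
    then have "m * \<bar>hop (Suc k mod g) - hop k\<bar> \<le> m * 1"
      using assms(2) by (rule mult_left_mono)
    also have "\<dots> \<le> a (i + k)"
      using assms(1) by simp
    finally show "\<bar>m * hop (Suc k mod g) - m * hop k\<bar> \<le> a (i + k)"
      using assms(2) by (simp add: abs_mult flip: right_diff_distrib)
  qed (use False assms in auto)
  then show ?thesis by (simp add: cycle_hop_def)
qed

text \<open>One route takes \<open>r\<close> hops forward; the other is the walk of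
  \<open>g - r\<close> hops from \<open>C (i + r)\<close> on to \<open>C i\<close>, reversed by
  symmetry.\<close>

lemma wdist_le_hop:
  assumes "\<And>k. l k \<le> m" "r \<le> g"
  shows "D (C i) (C (i + r)) \<le> m * hop r"
proof -
  have forward: "D (C i) (C (i + r)) \<le> m * real r" for i r
  proof (induction r)
    case (Suc r)
    have "D (C i) (C (i + Suc r)) \<le> D (C i) (C (i + r)) + l (i + r)"
      unfolding l_def using wdist_triangle by simp
    then show ?case
      using Suc assms(1)[of "i + r"] by (simp add: algebra_simps)
  qed simp
  have "C (i + r + (g - r)) = C i"
    using assms(2) by (intro C_cong) simp
  then have "D (C i) (C (i + r)) \<le> m * real (g - r)"
    using forward[of "i + r" "g - r"] wdist_commute[of "C i" "C (i + r)"] by simp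
  then show ?thesis
    using forward[of i r] by (simp add: cycle_hop_def min_def)
qed

lemma hop_1: "hop (Suc 0) = 1"
  using g by (simp add: cycle_hop_def)

lemma a_cong: "j mod g = k mod g \<Longrightarrow> a j = a k"
  unfolding a_def C_def by (metis mod_Suc_eq)

lemma l_cong: "j mod g = k mod g \<Longrightarrow> l j = l k"
  unfolding l_def C_def by (metis mod_Suc_eq)

lemma l_le_a: "l k \<le> a k"
  unfolding l_def a_def using edge_cyc by (rule wdist_le_weight)

text \<open>By periodicity the weights \<open>a\<close> have a positive minimum, which
  \<open>hop_le_wdist\<close> turns into a lower bound.\<close>

lemma l_pos: "l k > 0"
proof -
  define m where "m = Min (a ` {..<g})"
  have ne: "a ` {..<g} \<noteq> {}" "finite (a ` {..<g})"
    using g by (auto simp: lessThan_empty_iff)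
  have "m > 0"
    unfolding m_def using ne a_pos by (subst Min_gr_iff) auto
  moreover have "m \<le> a k" for k
  proof -
    have "a k = a (k mod g)"
      by (rule a_cong) simp
    then show ?thesis
      unfolding m_def using ne by (simp add: Min_le)
  qed
  ultimately have "m * hop (Suc 0) \<le> D (C k) (C (k + Suc 0))"
    using g by (intro hop_le_wdist) auto
  then show ?thesis
    using \<open>m > 0\<close> hop_1 by (simp add: l_def)
qed

subsection \<open>Curvature of the two kinds of edges\<close>

text \<open>\<open>(1 - \<alpha>) / d\<close> is the mass \<open>\<epsilon>\<close> at each
  neighbour of a cycle vertex. The last bound keeps the amounts \<open>\<alpha> - \<epsilon>\<close>
  and \<open>\<alpha> - 2 * \<epsilon>\<close> in the plans below nonnegative.\<close>

lemma lazy_mass: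
  assumes "1/2 < \<alpha>" "\<alpha> < 1"
  shows "\<alpha> = 1 - (n + 2) * ((1 - \<alpha>) / d)" "0 \<le> (1 - \<alpha>) / d" "2 * ((1 - \<alpha>) / d) \<le> \<alpha>"
proof -
  show "\<alpha> = 1 - (n + 2) * ((1 - \<alpha>) / d)" "0 \<le> (1 - \<alpha>) / d"
    using assms by (auto simp: d_eq field_simps)
  have "(1 - \<alpha>) / d \<le> (1 - \<alpha>) / 3"
    using assms d by (intro divide_left_mono) auto
  moreover have "2 * x \<le> \<alpha>" if "x \<le> (1 - \<alpha>) / 3" for x :: real
    using assms that by simp
  ultimately show "2 * ((1 - \<alpha>) / d) \<le> \<alpha>"
    by blast
qed

text \<open>An optimal plan keeps the mass already at the leaf, collects that of the other
  neighbours at \<open>C (Suc k)\<close>, and sends what the leaf still lacks along the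
  edge.\<close>

lemma leaf_curvature_iff:
  fixes \<kappa> :: real
  assumes j: "j < n"
  shows "has_lly_curvature E w (C (Suc k)) (L (Suc k) j) \<kappa> \<longleftrightarrow>
    d * \<kappa> * b (Suc k) j = (d + 2) * b (Suc k) j - (B (Suc k) + l k + l (Suc k))"
proof -
  let ?x = "C (Suc k)" and ?y = "L (Suc k) j" and ?b = "b (Suc k)"
  have dist: "D ?x ?y = ?b j"
    using j by (rule wdist_C_leaf)
  have "wasserstein D (lazy_step E \<alpha> ?x) (lazy_step E \<alpha> ?y) =
      D ?x ?y - (1 - \<alpha>) / d * ((d + 2) * ?b j - (B (Suc k) + l k + l (Suc k)))"
    if \<alpha>: "1/2 < \<alpha>" "\<alpha> < 1" for \<alpha>
  proof -
    define \<epsilon> where "\<epsilon> = (1 - \<alpha>) / d"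
    have \<alpha>_eq: "\<alpha> = 1 - (n + 2) * \<epsilon>" and \<epsilon>: "0 \<le> \<epsilon>" "2 * \<epsilon> \<le> \<alpha>"
      unfolding \<epsilon>_def using lazy_mass[OF \<alpha>] by auto
    \<comment> \<open>Entries below \<open>n\<close> treat the leaf masses. Then the two cycle
      neighbours move to \<open>?x\<close>, entry \<open>n + 2\<close> ships
      \<open>\<alpha> - \<epsilon>\<close> to \<open>?y\<close>, and entry \<open>n + 3\<close>
      stays at \<open>?x\<close>.\<close>
    define u where "u t = (if t < n then L (Suc k) t else [C (k + 2), C k, ?x, ?x] ! (t - n))" for t
    define v where "v t = (if t < n then (if t = j then ?y else ?x) else [?x, ?x, ?y, ?x] ! (t - n))" for t
    define wt where "wt t = (if t = n + 2 then \<alpha> - \<epsilon> else \<epsilon>)" for t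
    \<comment> \<open>The distance from \<open>?x\<close>, negated at \<open>?y\<close>: this is
      tight on every pair used by the plan.\<close>
    define f where "f z = (if z = ?y then - ?b j else D ?x z)" for z
    have split4: "sum F {..<n + 4} = (\<Sum>t<n. F t) + F n + F (n + 1) + F (n + 2) + F (n + 3)"
      for F :: "nat \<Rightarrow> real"
      by (simp add: eval_nat_numeral)
    have sum_j: "(\<Sum>t<n. if t = j then P else F t) = (\<Sum>t<n. F t) - F j + P"
      for F :: "nat \<Rightarrow> real" and P
    proof -
      have "(\<Sum>t<n. if t = j then P else F t) = (\<Sum>t<n. F t + (if t = j then P - F j else 0))"
        by (rule sum.cong) auto
      then show ?thesis
        using j by (simp add: sum.distrib)
    qed
    have lk: "D ?x (C k) = l k" "D (C k) ?x = l k" 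
      "D ?x (C (Suc (Suc k))) = l (Suc k)" "D (C (Suc (Suc k))) ?x = l (Suc k)"
      by (simp_all add: l_def wdist_commute)
    have E_x: "measure_pmf.expectation (lazy_step E \<alpha> ?x) h =
        \<alpha> * h ?x + \<epsilon> * (h (C (k + 2)) + h (C k) + (\<Sum>t<n. h (L (Suc k) t)))" for h :: "_ \<Rightarrow> real"
      using expectation_C[of \<alpha> k h] \<alpha> by (simp add: \<epsilon>_def)
    have E_y: "measure_pmf.expectation (lazy_step E \<alpha> ?y) h = \<alpha> * h ?y + (1 - \<alpha>) * h ?x"
      for h :: "_ \<Rightarrow> real"
      using expectation_L[OF _ _ j, of \<alpha>] \<alpha> by simp
    have "wasserstein D (lazy_step E \<alpha> ?x) (lazy_step E \<alpha> ?y) =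
        ?b j - \<epsilon> * ((d + 2) * ?b j - (B (Suc k) + l k + l (Suc k)))"
    proof (rule wasserstein_eqI[where T = "{..<n + 4}" and u = u and v = v and wt = wt and f = f])
      show "0 \<le> wt t" for t
        using \<epsilon> by (simp add: wt_def)
      show "finite (set_pmf (lazy_step E \<alpha> ?x))"
        by (rule finite_lazy_step_C)
      show "finite (set_pmf (lazy_step E \<alpha> ?y))"
        using j by (rule finite_lazy_step_L)
      show "(\<Sum>t<n + 4. wt t * h (u t)) = measure_pmf.expectation (lazy_step E \<alpha> ?x) h"
        for h :: "_ \<Rightarrow> real"
        unfolding E_x split4
        by (simp add: u_def wt_def algebra_simps sum_distrib_left)
      have "(\<Sum>t<n. wt t * h (v t)) = \<epsilon> * (\<Sum>t<n. if t = j then h ?y else h ?x)" for h :: "_ \<Rightarrow> real"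
        unfolding sum_distrib_left by (rule sum.cong) (auto simp: v_def wt_def)
      then show "(\<Sum>t<n + 4. wt t * h (v t)) = measure_pmf.expectation (lazy_step E \<alpha> ?y) h"
        for h :: "_ \<Rightarrow> real"
        unfolding E_y split4 sum_j
        by (simp add: v_def wt_def \<alpha>_eq algebra_simps)
      show "f x' - f y' \<le> D x' y'"
        if "x' \<in> set_pmf (lazy_step E \<alpha> ?x)" "y' \<in> set_pmf (lazy_step E \<alpha> ?y)" for x' y'
      proof -
        have V: "x' \<in> V" "y' \<in> V"
          using that set_lazy_step_C set_lazy_step_L[OF j] by blast+
        have bj: "?b j > 0"
          using j by (rule b_pos)
        show ?thesis
        proof (cases "x' = ?y")
          case True
          then show ?thesis
            using V bj wdist_nonneg[of ?x y'] wdist_nonneg[of x' y'] by (simp add: f_def)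
        next
          case x': False
          show ?thesis
          proof (cases "y' = ?y")
            case True
            then show ?thesis
              using x' wdist_leaf[OF j V(1) x'] wdist_commute[OF V] by (simp add: f_def)
          next
            case False
            then show ?thesis
              using x' wdist_triangle[OF C_in V(2,1), of "Suc k"] wdist_commute[OF V] by (simp add: f_def)
          qed
        qed
      qed
      have "(\<Sum>t<n. f (L (Suc k) t)) = (\<Sum>t<n. if t = j then - ?b j else ?b t)"
        by (rule sum.cong) (auto simp: f_def wdist_C_leaf)
      then have f_leaves: "(\<Sum>t<n. f (L (Suc k) t)) = B (Suc k) - 2 * ?b j"
        unfolding sum_j by (simp add: B_def)
      show "measure_pmf.expectation (lazy_step E \<alpha> ?x) f - measure_pmf.expectation (lazy_step E \<alpha> ?y) f =
          ?b j - \<epsilon> * ((d + 2) * ?b j - (B (Suc k) + l k + l (Suc k)))"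
        unfolding E_x E_y f_leaves by (simp add: f_def lk \<alpha>_eq d_eq algebra_simps)
      have "(\<Sum>t<n. wt t * D (u t) (v t)) = \<epsilon> * (\<Sum>t<n. if t = j then 0 else ?b t)"
        unfolding sum_distrib_left by (rule sum.cong) (auto simp: u_def v_def wt_def wdist_leaf_C)
      then show "(\<Sum>t<n + 4. wt t * D (u t) (v t)) =
          ?b j - \<epsilon> * ((d + 2) * ?b j - (B (Suc k) + l k + l (Suc k)))"
        unfolding split4 sum_j
        by (simp add: u_def v_def wt_def lk dist \<alpha>_eq d_eq B_def algebra_simps)
    qed simp
    then show ?thesis
      by (simp add: dist \<epsilon>_def)
  qed
  then show ?thesis
    using d b_pos[OF j] by (subst has_lly_curvature_iff[where n = d]) (auto simp: dist)
qed

text \<open>The plan depends on the weighting only through the choice of pairing in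
  \<open>M k\<close>, and one formula for the potential certifies both choices.\<close>

lemma cycle_curvature_iff:
  fixes \<kappa> :: real
  shows "has_lly_curvature E w (C (Suc k)) (C (k + 2)) \<kappa> \<longleftrightarrow>
    d * \<kappa> * l (Suc k) = 4 * l (Suc k) - (B (Suc k) + B (k + 2) + M k)"
proof -
  let ?p = "C k" and ?x = "C (Suc k)" and ?y = "C (k + 2)" and ?q = "C (k + 3)"
  let ?l = "l (Suc k)"
  have dist: "D ?x ?y = ?l" "D ?y ?x = ?l"
    by (simp_all add: l_def wdist_commute)
  have neq: "Suc k mod g \<noteq> (k + 2) mod g"
    using index_neq[of 1 "Suc k"] g by simp
  have y_Suc: "C (Suc (Suc k)) = ?y" "C (Suc k + 2) = ?q"
    by (simp_all add: eval_nat_numeral)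
  \<comment> \<open>The destinations of \<open>?p\<close> and \<open>?x\<close> in a pairing that
    attains the minimum \<open>M k\<close>.\<close>
  obtain r s where rs: "r = ?q \<and> s = ?y \<or> r = ?y \<and> s = ?q" and M_rs: "M k = D ?p r + D ?x s"
  proof (cases "l (Suc k) + D ?p ?q \<le> D ?p ?y + D ?x ?q")
    case True
    then show ?thesis
      using that[of ?q ?y] dist by (simp add: M_def)
  next
    case False
    then show ?thesis
      using that[of ?y ?q] by (simp add: M_def)
  qed
  have rs_V: "r \<in> V" "s \<in> V"
    using rs by auto
  text \<open>The optimal potential is the largest lower bound forced by its values at \<open>?x\<close> and \<open>?p\<close>,
    corrected on the leaves of \<open>?x\<close>, whose mass must leave through \<open>?x\<close>.\<close>
  define F where "F z = max (- D ?x z) (D ?p ?y - ?l - D ?p z)" for z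
  define f where "f z = (if z \<in> L (Suc k) ` {..<n} then D ?x z else F z)" for z
  have F_lip: "F u - F v \<le> D u v" if "u \<in> V" "v \<in> V" for u v
    using wdist_triangle[OF C_in that, of "Suc k"] wdist_triangle[OF C_in that, of k]
    by (simp add: F_def max_def)
  have F_x: "F ?x = 0"
    using wdist_triangle[of ?p ?x ?y] dist by (simp add: F_def)
  \<comment> \<open>From a leaf of \<open>?x\<close> to any other vertex \<open>v\<close> the
    distance splits at \<open>?x\<close>, so \<open>- D ?x v \<le> F v\<close> suffices there; if
    \<open>u\<close> is not such a leaf, \<open>f v\<close> is at least \<open>F v\<close>.\<close>
  have f_lip: "f u - f v \<le> D u v" if uv: "u \<in> V" "v \<in> V" for u v
  proof -
    have F_lower: "- D ?x z \<le> F z" for z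
      by (simp add: F_def)
    have F_upper: "F z \<le> D ?x z" if "z \<in> V" for z
      using F_lip[of z ?x] F_x that wdist_commute[of z ?x] by simp
    show ?thesis
    proof (cases "u \<in> L (Suc k) ` {..<n}")
      case True
      then obtain t where t: "t < n" "u = L (Suc k) t"
        by auto
      show ?thesis
      proof (cases "v \<in> L (Suc k) ` {..<n}")
        case v: True
        then show ?thesis
          using True wdist_triangle[OF C_in uv(2,1), of "Suc k"] wdist_commute[OF uv]
          by (simp add: f_def)
      next
        case False
        then have "v \<noteq> u"
          using True by auto
        then show ?thesis
          using True False t wdist_leaf[OF t(1) uv(2), of "Suc k"] wdist_C_leaf[OF t(1), of "Suc k"]
            F_lower[of v]
          by (simp add: f_def)
      qed
    next
      case False
      then show ?thesis
        using F_lip[OF uv] F_upper[OF uv(2)] by (simp add: f_def)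
    qed
  qed
  have f_C: "f (C i) = F (C i)" for i
    by (auto simp: f_def)
  have f_y: "F ?y = - ?l"
    by (simp add: F_def dist del: add_2_eq_Suc')
  have f_p: "F ?p = D ?p ?y - ?l"
    using wdist_triangle[of ?x ?p ?y] dist by (simp add: F_def)
  \<comment> \<open>Negating the maximum in \<open>F ?q\<close> produces the minimum in
    \<open>M k\<close>; here the potential meets the cheaper pairing.\<close>
  have f_pq: "F ?p - F ?q = M k - ?l"
    unfolding f_p by (simp add: F_def M_def max_def min_def)
  have f_Lx: "f (L (Suc k) t) = b (Suc k) t" if "t < n" for t
    using that by (auto simp: f_def wdist_C_leaf)
  have f_Ly: "f (L (k + 2) t) = - ?l - b (k + 2) t" if "t < n" for t
  proof -
    have "D (C i) (L (k + 2) t) = b (k + 2) t + D (C i) ?y" for i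
      using wdist_leaf[OF that, of "C i" "k + 2"] wdist_commute[of "C i" "L (k + 2) t"]
        wdist_commute[of "C i" ?y] that by simp
    moreover have "L (k + 2) t \<notin> L (Suc k) ` {..<n}"
      using neq by auto
    ultimately show ?thesis
      by (simp add: f_def F_def dist del: add_2_eq_Suc')
  qed
  have "wasserstein D (lazy_step E \<alpha> ?x) (lazy_step E \<alpha> ?y) =
      D ?x ?y - (1 - \<alpha>) / d * (4 * ?l - (B (Suc k) + B (k + 2) + M k))"
    if \<alpha>: "1/2 < \<alpha>" "\<alpha> < 1" for \<alpha>
  proof -
    define \<epsilon> where "\<epsilon> = (1 - \<alpha>) / d"
    have \<alpha>_eq: "\<alpha> = 1 - (n + 2) * \<epsilon>" and \<epsilon>: "0 \<le> \<epsilon>" "2 * \<epsilon> \<le> \<alpha>"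
      unfolding \<epsilon>_def using lazy_mass[OF \<alpha>] by auto
    \<comment> \<open>Entries below \<open>n\<close> match the leaves in pairs. Then come the
      pairing behind \<open>M k\<close>, the masses that stay at \<open>?x\<close> and
      \<open>?y\<close>, and at entry \<open>n + 4\<close> the bulk
      \<open>\<alpha> - 2 * \<epsilon>\<close> along the edge.\<close>
    define u where "u t = (if t < n then L (Suc k) t else [?p, ?x, ?x, ?y, ?x] ! (t - n))" for t
    define v where "v t = (if t < n then L (k + 2) t else [r, s, ?x, ?y, ?y] ! (t - n))" for t
    define wt where "wt t = (if t = n + 4 then \<alpha> - 2 * \<epsilon> else \<epsilon>)" for t
    have split5: "sum F {..<n + 5} = (\<Sum>t<n. F t) + F n + F (n + 1) + F (n + 2) + F (n + 3) + F (n + 4)"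
      for F :: "nat \<Rightarrow> real"
      by (simp add: eval_nat_numeral)
    have E_x: "measure_pmf.expectation (lazy_step E \<alpha> ?x) h =
        \<alpha> * h ?x + \<epsilon> * (h ?y + h ?p + (\<Sum>t<n. h (L (Suc k) t)))" for h :: "_ \<Rightarrow> real"
      using expectation_C[of \<alpha> k h] \<alpha> by (simp add: \<epsilon>_def)
    have E_y: "measure_pmf.expectation (lazy_step E \<alpha> ?y) h =
        \<alpha> * h ?y + \<epsilon> * (h ?q + h ?x + (\<Sum>t<n. h (L (k + 2) t)))" for h :: "_ \<Rightarrow> real"
      using expectation_C[of \<alpha> "Suc k" h] \<alpha> unfolding y_Suc by (simp add: \<epsilon>_def)
    have "wasserstein D (lazy_step E \<alpha> ?x) (lazy_step E \<alpha> ?y) =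
        ?l - \<epsilon> * (4 * ?l - (B (Suc k) + B (k + 2) + M k))"
    proof (rule wasserstein_eqI[where T = "{..<n + 5}" and u = u and v = v and wt = wt and f = f])
      show "0 \<le> wt t" for t
        using \<epsilon> by (simp add: wt_def)
      show "finite (set_pmf (lazy_step E \<alpha> ?x))" "finite (set_pmf (lazy_step E \<alpha> ?y))"
        using finite_lazy_step_C[of \<alpha> k] finite_lazy_step_C[of \<alpha> "Suc k"] by simp_all
      show "(\<Sum>t<n + 5. wt t * h (u t)) = measure_pmf.expectation (lazy_step E \<alpha> ?x) h"
        for h :: "_ \<Rightarrow> real"
        unfolding E_x split5
        by (simp add: u_def wt_def algebra_simps sum_distrib_left)
      show "(\<Sum>t<n + 5. wt t * h (v t)) = measure_pmf.expectation (lazy_step E \<alpha> ?y) h"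
        for h :: "_ \<Rightarrow> real"
        using rs unfolding E_y split5
        by (auto simp: v_def wt_def algebra_simps sum_distrib_left)
      show "f x' - f y' \<le> D x' y'"
        if "x' \<in> set_pmf (lazy_step E \<alpha> ?x)" "y' \<in> set_pmf (lazy_step E \<alpha> ?y)" for x' y'
        using that set_lazy_step_C[of \<alpha> k] set_lazy_step_C[of \<alpha> "Suc k"]
        by (intro f_lip) auto
      have "measure_pmf.expectation (lazy_step E \<alpha> ?x) f = \<epsilon> * (- ?l + F ?p + B (Suc k))"
        unfolding E_x f_C F_x f_y by (simp add: f_Lx B_def)
      moreover have "measure_pmf.expectation (lazy_step E \<alpha> ?y) f =
          - \<alpha> * ?l + \<epsilon> * (F ?q - n * ?l - B (k + 2))"
        unfolding E_y f_C F_x f_y by (simp add: f_Ly B_def sum_subtractf del: add_2_eq_Suc')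
      ultimately show "measure_pmf.expectation (lazy_step E \<alpha> ?x) f -
          measure_pmf.expectation (lazy_step E \<alpha> ?y) f =
          ?l - \<epsilon> * (4 * ?l - (B (Suc k) + B (k + 2) + M k))"
        using f_pq by (simp add: \<alpha>_eq) algebra
      have "D (L (Suc k) t) (L (k + 2) t) = b (Suc k) t + ?l + b (k + 2) t" if "t < n" for t
        using wdist_leaf[OF that, of "L (k + 2) t" "Suc k"] wdist_leaf[OF that, of ?x "k + 2"]
          wdist_commute[of ?x "L (k + 2) t"] that neq dist by simp
      then have "(\<Sum>t<n. wt t * D (u t) (v t)) = \<epsilon> * (\<Sum>t<n. b (Suc k) t + ?l + b (k + 2) t)"
        unfolding sum_distrib_left by (intro sum.cong) (auto simp: u_def v_def wt_def)
      also have "\<dots> = \<epsilon> * (B (Suc k) + n * ?l + B (k + 2))"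
        by (simp add: sum.distrib B_def)
      finally show "(\<Sum>t<n + 5. wt t * D (u t) (v t)) =
          ?l - \<epsilon> * (4 * ?l - (B (Suc k) + B (k + 2) + M k))"
        unfolding split5 M_rs
        by (simp add: u_def v_def wt_def dist \<alpha>_eq algebra_simps del: add_2_eq_Suc')
    qed simp
    then show ?thesis
      by (simp add: dist \<epsilon>_def del: add_2_eq_Suc')
  qed
  then show ?thesis
    using d l_pos[of "Suc k"]
    by (subst has_lly_curvature_iff[where n = d]) (auto simp: dist simp del: add_2_eq_Suc')
qed

end

section \<open>The Einstein equations\<close>

text \<open>The last term of the curvature formula, on a cycle whose edges all have length one.\<close>

definition cycle_min :: "nat \<Rightarrow> real" where
  "cycle_min g = min (1 + cycle_hop g 3) (2 * cycle_hop g 2)"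

context weighted_sun
begin

text \<open>The substitution \<open>c = 4 - d * \<kappa>\<close> is a bijection of the reals as
  \<open>d > 0\<close>. Indices of the form \<open>Suc k\<close> reach every cycle vertex because
  they count modulo \<open>g\<close>.\<close>

lemma discrete_Einstein_iff:
  "discrete_Einstein E w \<longleftrightarrow> (\<exists>c. \<forall>k. c * l (Suc k) = B (Suc k) + B (k + 2) + M k \<and>
      (\<forall>j<n. (c + n) * b (Suc k) j = B (Suc k) + l k + l (Suc k)))"
proof -
  have edges: "(\<forall>x y. {x, y} \<in> E \<longrightarrow> has_lly_curvature E w x y \<kappa>) \<longleftrightarrow>
      (\<forall>k. has_lly_curvature E w (C (Suc k)) (C (k + 2)) \<kappa> \<and>
        (\<forall>j<n. has_lly_curvature E w (C (Suc k)) (L (Suc k) j) \<kappa>))" (is "?A \<longleftrightarrow> ?B") for \<kappa> :: real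
  proof
    assume ?A
    then show ?B
      using edge_cyc edge_leaf by simp
  next
    assume ?B
    show ?A
    proof (intro allI impI)
      fix x y assume xy: "{x, y} \<in> E"
      have sym: "has_lly_curvature E w x y \<kappa>"
        if "{x, y} = {x', y'}" "has_lly_curvature E w x' y' \<kappa>" for x' y'
        using that has_lly_curvature_commute[OF xy] by (auto simp: doubleton_eq_iff)
      have C_eq: "\<exists>k'. C k = C (Suc k') \<and> C (Suc k) = C (k' + 2) \<and> L k = L (Suc k')" for k
      proof -
        obtain k' where k': "k mod g = Suc k' mod g"
          using exists_index by blast
        then have "Suc k mod g = (k' + 2) mod g"
          using mod_Suc_eq[of k g] mod_Suc_eq[of "Suc k'" g] by simp
        with k' show ?thesis
          by (intro exI[of _ k']) (simp add: C_def L_def fun_eq_iff)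
      qed
      from xy show "has_lly_curvature E w x y \<kappa>"
      proof (cases rule: edge_cases)
        case (1 k)
        with C_eq[of k] \<open>?B\<close> show ?thesis
          using sym by metis
      next
        case (2 k j)
        with C_eq[of k] \<open>?B\<close> show ?thesis
          using sym by metis
      qed
    qed
  qed
  have "(\<forall>x y. {x, y} \<in> E \<longrightarrow> has_lly_curvature E w x y \<kappa>) \<longleftrightarrow>
      (\<forall>k. (4 - d * \<kappa>) * l (Suc k) = B (Suc k) + B (k + 2) + M k \<and>
      (\<forall>j<n. (4 - d * \<kappa> + n) * b (Suc k) j = B (Suc k) + l k + l (Suc k)))" for \<kappa> :: real
  proof -
    have "d * \<kappa> * l (Suc k) = 4 * l (Suc k) - (B (Suc k) + B (k + 2) + M k) \<longleftrightarrow>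
        (4 - d * \<kappa>) * l (Suc k) = B (Suc k) + B (k + 2) + M k" for k
      by (simp only: left_diff_distrib) linarith
    moreover have "d * \<kappa> * b (Suc k) j = (d + 2) * b (Suc k) j - (B (Suc k) + l k + l (Suc k)) \<longleftrightarrow>
        (4 - d * \<kappa> + n) * b (Suc k) j = B (Suc k) + l k + l (Suc k)" for k j
    proof -
      have "(4 - d * \<kappa> + n) * b (Suc k) j = (d + 2) * b (Suc k) j - d * \<kappa> * b (Suc k) j"
        by (simp add: d_eq algebra_simps)
      then show ?thesis by linarith
    qed
    ultimately show ?thesis
      unfolding edges cycle_curvature_iff using leaf_curvature_iff by simp
  qed
  moreover have "(\<exists>\<kappa>::real. P (4 - d * \<kappa>)) \<longleftrightarrow> (\<exists>c. P c)" for P :: "real \<Rightarrow> bool"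
  proof
    assume "\<exists>c. P c"
    then obtain c where "P c" ..
    moreover have "4 - d * ((4 - c) / d) = c"
      using d by simp
    ultimately show "\<exists>\<kappa>::real. P (4 - d * \<kappa>)"
      by metis
  qed auto
  ultimately show ?thesis
    unfolding discrete_Einstein_def using pos by simp
qed

text \<open>Comparison with the cycle of constant weight \<open>m\<close>, for which the last term
  is \<open>m * cycle_min g\<close>.\<close>

lemma M_le:
  assumes "\<And>k. l k \<le> m"
  shows "M k \<le> m * cycle_min g"
proof -
  have "0 \<le> m"
    using assms[of 0] l_pos[of 0] by simp
  have "D (C k) (C (k + 3)) \<le> m * hop 3" "D (C k) (C (k + 2)) \<le> m * hop 2"
    "D (C (Suc k)) (C (Suc k + 2)) \<le> m * hop 2"
    using g assms by (intro wdist_le_hop; simp)+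
  moreover have "C (Suc k + 2) = C (k + 3)"
    by (simp add: eval_nat_numeral)
  ultimately have "M k \<le> min (m + m * hop 3) (m * hop 2 + m * hop 2)"
    unfolding M_def using assms[of "Suc k"] by (intro min.mono add_mono) auto
  also have "\<dots> = m * cycle_min g"
    using \<open>0 \<le> m\<close> by (simp add: cycle_min_def min_mult_distrib_left algebra_simps)
  finally show ?thesis .
qed

text \<open>The comparison from below. \<open>hop_le_wdist\<close> asks for bounds on the weights,
  which \<open>l k \<le> a k\<close> supplies.\<close>

lemma le_M:
  assumes "\<And>k. m \<le> l k" "0 \<le> m"
  shows "m * cycle_min g \<le> M k"
proof -
  have "m \<le> a k" for k
    using assms(1) l_le_a order_trans by blast
  then have "m * hop 3 \<le> D (C k) (C (k + 3))" "m * hop 2 \<le> D (C k) (C (k + 2))"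
    "m * hop 2 \<le> D (C (Suc k)) (C (Suc k + 2))"
    using g assms by (intro hop_le_wdist; simp)+
  moreover have "C (Suc k + 2) = C (k + 3)"
    by (simp add: eval_nat_numeral)
  ultimately have "min (m + m * hop 3) (m * hop 2 + m * hop 2) \<le> M k"
    unfolding M_def using assms(1)[of "Suc k"] by (intro min.mono add_mono) auto
  moreover have "min (m + m * hop 3) (m * hop 2 + m * hop 2) = m * cycle_min g"
    using \<open>0 \<le> m\<close> by (simp add: cycle_min_def min_mult_distrib_left algebra_simps)
  ultimately show ?thesis by simp
qed

section \<open>Regular weightings and the Einstein equations\<close>

lemma leaf_edge_iff: "(\<exists>i j. Leaf i j \<in> {C k, L m t})" "\<not> (\<exists>i j. Leaf i j \<in> {C k, C m})"
  by (auto simp: C_def L_def)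

text \<open>With these weights the leaf equations hold identically, and the cycle equation times
  \<open>c\<close> is the quadratic equation assumed for \<open>c\<close>.\<close>

lemma Einstein_if_regular:
  assumes c: "0 < c" "c * c = 4 * real (d - 2) + c * cycle_min g"
    and w: "\<And>e. e \<in> E \<Longrightarrow> w e = (if \<exists>i j. Leaf i j \<in> e then 2 / c else 1)"
  shows "discrete_Einstein E w"
proof -
  have a: "a k = 1" for k
    unfolding a_def w[OF edge_cyc] using leaf_edge_iff(2) by simp
  have b: "b k j = 2 / c" if "j < n" for k j
    unfolding b_def w[OF edge_leaf[OF that]] using leaf_edge_iff(1) by simp
  have l: "l k = 1" for k
    using l_le_a[of k] hop_le_wdist[of 1 "Suc 0" k] a hop_1 g by (simp add: l_def)
  have M: "M k = cycle_min g" for k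
    using M_le[of 1 k] le_M[of 1 k] l by simp
  have B: "B k = n * (2 / c)" for k
    unfolding B_def using b by simp
  have "c * 1 = n * (2 / c) + n * (2 / c) + cycle_min g"
    using c by (simp add: field_simps n_def)
  moreover have "(c + n) * (2 / c) = n * (2 / c) + 1 + 1"
    using c by (simp add: field_simps)
  ultimately show ?thesis
    unfolding discrete_Einstein_iff l M B using b by (intro exI[of _ c]) simp
qed

text \<open>The quadratic equation does not involve the weighting, so only the scale
  \<open>t\<close> remains free once its positive root is known to be unique.\<close>

lemma regular_if_Einstein:
  assumes "discrete_Einstein E w"
  obtains t c where "0 < t" "0 < c" "c * c = 4 * real (d - 2) + c * cycle_min g"
    "\<And>e. e \<in> E \<Longrightarrow> w e = (if \<exists>i j. Leaf i j \<in> e then 2 * t / c else t)"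
proof -
  obtain c where eq_l: "\<And>k. c * l (Suc k) = B (Suc k) + B (k + 2) + M k"
    and eq_b: "\<And>k j. j < n \<Longrightarrow> (c + n) * b (Suc k) j = B (Suc k) + l k + l (Suc k)"
    using assms unfolding discrete_Einstein_iff by metis
  \<comment> \<open>Summing the leaf equation over the \<open>n\<close> leaves gives
    \<open>n * B (Suc k)\<close> on both sides, which cancels.\<close>
  have eq_B: "c * B (Suc k) = n * (l k + l (Suc k))" for k
  proof -
    have "(c + n) * B (Suc k) = (\<Sum>j<n. B (Suc k) + l k + l (Suc k))"
      unfolding B_def[of "Suc k"] sum_distrib_left by (rule sum.cong) (simp_all add: eq_b flip: B_def)
    then show ?thesis
      by (simp add: algebra_simps)
  qed
  have B_pos: "B k > 0" for k
    unfolding B_def using n_pos b_pos by (intro sum_pos) (auto simp: lessThan_empty_iff)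
  have c: "c > 0"
  proof -
    have "c * B (Suc 0) > 0"
      unfolding eq_B using n_pos l_pos by (simp add: add_pos_pos)
    then show ?thesis
      using B_pos[of "Suc 0"] by (simp add: zero_less_mult_iff)
  qed
  have eq: "c * c * l (Suc k) = n * (l k + 2 * l (Suc k) + l (k + 2)) + c * M k" for k
  proof -
    have "c * c * l (Suc k) = c * B (Suc k) + c * B (Suc (Suc k)) + c * M k"
      using eq_l[of k] by (simp add: algebra_simps)
    then show ?thesis
      unfolding eq_B by (simp add: algebra_simps)
  qed
  text \<open>The right-hand side is monotone in \<open>l\<close>, so the maximum and the minimum of \<open>l\<close> are
    compared with the constant solution.\<close>
  have range: "l k \<in> l ` {..<g}" for k
    using l_cong[of k "k mod g"] by auto
  define mx mn where "mx = Max (l ` {..<g})" and "mn = Min (l ` {..<g})"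
  have mx: "l k \<le> mx" and mn: "mn \<le> l k" for k
    unfolding mx_def mn_def using range by auto
  have "mx \<in> l ` {..<g}" "mn \<in> l ` {..<g}"
    unfolding mx_def mn_def using range by (auto intro!: Max_in Min_in)
  then obtain i j where i: "i < g" "l i = mx" and j: "l j = mn"
    by auto
  have mx_pos: "mx > 0" and mn_pos: "mn > 0"
    using l_pos[of i] l_pos[of j] i j by auto
  obtain i' j' where "i mod g = Suc i' mod g" "j mod g = Suc j' mod g"
    using exists_index by metis
  then have i': "l (Suc i') = mx" and j': "l (Suc j') = mn"
    using i j l_cong by metis+
  have M_mx: "c * M k \<le> c * (mx * cycle_min g)" and M_mn: "c * (mn * cycle_min g) \<le> c * M k" for k
    using M_le[OF mx] le_M[OF mn] mn_pos c by auto
  have "c * c * mx \<le> (4 * n + c * cycle_min g) * mx"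
  proof -
    have "n * (l i' + 2 * mx + l (i' + 2)) \<le> n * (4 * mx)"
      using mx[of i'] mx[of "i' + 2"] by (intro mult_left_mono) auto
    then show ?thesis
      using eq[of i'] M_mx[of i'] unfolding i' by (simp add: algebra_simps)
  qed
  moreover have "(4 * n + c * cycle_min g) * mn \<le> c * c * mn"
  proof -
    have "n * (4 * mn) \<le> n * (l j' + 2 * mn + l (j' + 2))"
      using mn[of j'] mn[of "j' + 2"] by (intro mult_left_mono) auto
    then show ?thesis
      using eq[of j'] M_mn[of j'] unfolding j' by (simp add: algebra_simps)
  qed
  ultimately have c_eq: "c * c = 4 * n + c * cycle_min g"
    using mx_pos mn_pos by (simp add: antisym)
  \<comment> \<open>By \<open>c_eq\<close> the estimate at a maximum is an equality, which forces
    both neighbouring values to be maximal.\<close>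
  have next_mx: "l (Suc m) = mx" if m: "l m = mx" for m
  proof -
    obtain k where k: "m mod g = Suc k mod g"
      using exists_index by blast
    then have lk: "l (Suc k) = mx" "l (Suc m) = l (k + 2)"
      using m l_cong[of m "Suc k"] l_cong[of "Suc m" "k + 2"] mod_Suc_eq[of m g] mod_Suc_eq[of "Suc k" g]
      by simp_all
    have "n * (4 * mx) \<le> n * (l k + 2 * mx + l (k + 2))"
      using eq[of k] M_mx[of k] c_eq unfolding lk(1) by (simp add: algebra_simps)
    then have "4 * mx \<le> l k + 2 * mx + l (k + 2)"
      using n_pos by simp
    then show ?thesis
      using mx[of k] mx[of "k + 2"] lk(2) by linarith
  qed
  have l_shift: "l (i + m) = mx" for m
    by (induction m) (use i next_mx in auto)
  have l: "l k = mx" for k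
  proof -
    have "i + (k + g - i) = k + g"
      using i(1) by simp
    then show ?thesis
      using l_shift[of "k + g - i"] l_cong[of "k + g" k] by simp
  qed
  have a: "a k = mx" for k
  proof (rule ccontr)
    assume "a k \<noteq> mx"
    then have gt: "a k > mx"
      using l_le_a[of k] l[of k] by simp
    \<comment> \<open>Offsets start at \<open>C (Suc k)\<close>, so the closing edge is the heavy
      edge \<open>k\<close>. The potential climbs by \<open>mx\<close> per step and is capped at
      \<open>a k\<close> for that edge; as \<open>g - 1 \<ge> 2\<close>, it ends above
      \<open>mx\<close>.\<close>
    define \<psi> where "\<psi> r = min (mx * real r) (a k)" for r
    have last: "(Suc k + (g - 1)) mod g = k mod g"
      using g by simp
    have "\<psi> (g - 1) - \<psi> 0 \<le> D (C (Suc k)) (C (Suc k + (g - 1)))"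
    proof (rule potential_le_wdist_cycle)
      fix r assume r: "r < g"
      show "\<bar>\<psi> (Suc r mod g) - \<psi> r\<bar> \<le> a (Suc k + r)"
      proof (cases "Suc r = g")
        case True
        then have "r = g - 1"
          by simp
        with last have "a (Suc k + r) = a k"
          by (intro a_cong) (simp only:)
        then show ?thesis
          using True mx_pos gt by (simp add: \<psi>_def)
      next
        case False
        then have "\<bar>\<psi> (Suc r mod g) - \<psi> r\<bar> \<le> mx"
          using r mx_pos by (simp add: \<psi>_def min_def algebra_simps)
        also have "mx \<le> a (Suc k + r)"
          using l_le_a l by metis
        finally show ?thesis .
      qed
    qed (use g in simp)
    also have "\<dots> = l k"
      unfolding C_cong[OF last] l_def by (simp add: wdist_commute)
    finally have "\<psi> (g - 1) - \<psi> 0 \<le> mx"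
      unfolding l .
    moreover have "\<psi> 0 = 0"
      using gt mx_pos by (simp add: \<psi>_def)
    moreover have "mx * 1 < mx * real (g - 1)"
      using g mx_pos by (intro mult_strict_left_mono) auto
    then have "mx < \<psi> (g - 1)"
      unfolding \<psi>_def using gt by simp
    ultimately show False by simp
  qed
  have b: "b k t = 2 * mx / c" if t: "t < n" for k t
  proof -
    obtain k' where "k mod g = Suc k' mod g"
      using exists_index by blast
    then have "b k t = b (Suc k') t"
      by (simp add: b_def C_def L_def)
    \<comment> \<open>\<open>B (Suc k') + 2 * mx\<close> with
      \<open>B (Suc k') = n * (2 * mx) / c\<close> factors through \<open>c + n\<close>.\<close>
    moreover have "(c + n) * b (Suc k') t = (c + n) * (2 * mx / c)"
    proof -
      have "B (Suc k') = n * (2 * mx) / c"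
        using eq_B[of k'] c l by (simp add: field_simps)
      then show ?thesis
        using eq_b[OF t, of k'] c l by (simp add: field_simps)
    qed
    moreover have "c + n \<noteq> 0"
      using c by simp
    ultimately show ?thesis
      by (metis mult_cancel_left)
  qed
  show thesis
  proof (rule that[OF mx_pos c])
    show "c * c = 4 * real (d - 2) + c * cycle_min g"
      using c_eq by (simp add: n_def)
    show "w e = (if \<exists>i j. Leaf i j \<in> e then 2 * mx / c else mx)" if "e \<in> E" for e
      using that
    proof (cases rule: edge_cases)
      case (1 k)
      then show ?thesis
        using a[of k] leaf_edge_iff(2)[of k "Suc k"] by (simp add: a_def)
    next
      case (2 k t)
      then show ?thesis
        using b[of t k] leaf_edge_iff(1)[of k k t] by (simp add: b_def)
    qed
  qed
qed

end

section \<open>The quadratic equation for \<open>c\<close> and the conclusion\<close>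

theorem theoremC:
  fixes g d :: nat
  assumes "g \<ge> 3" and "d \<ge> 3"
  shows "\<exists>w. discrete_Einstein (sun_edges g d) w \<and>
           (\<forall>w'. discrete_Einstein (sun_edges g d) w' \<longrightarrow>
              (\<exists>c>0. \<forall>e\<in>sun_edges g d. w' e = c * w e))"
proof -
  define \<mu> where "\<mu> = cycle_min g"
  define \<nu> where "\<nu> = 4 * real (d - 2)"
  have \<nu>: "\<nu> > 0"
    using assms by (simp add: \<nu>_def)
  \<comment> \<open>The larger root of \<open>c * c = \<nu> + c * \<mu>\<close>, positive because
    the square root exceeds the absolute value of \<open>\<mu>\<close>.\<close>
  define c where "c = (\<mu> + sqrt (\<mu> * \<mu> + 4 * \<nu>)) / 2"
  have sq: "sqrt (\<mu> * \<mu> + 4 * \<nu>) * sqrt (\<mu> * \<mu> + 4 * \<nu>) = \<mu> * \<mu> + 4 * \<nu>"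
    using \<nu> by simp
  have c_eq: "c * c = \<nu> + c * \<mu>"
    using sq unfolding c_def by (simp add: field_simps)
  have c_pos: "c > 0"
  proof -
    have "sqrt (\<mu> * \<mu>) < sqrt (\<mu> * \<mu> + 4 * \<nu>)"
      using \<nu> by (intro real_sqrt_less_mono) simp
    then show ?thesis
      by (simp add: c_def real_sqrt_mult_self)
  qed
  \<comment> \<open>This excludes a second positive root: in
    \<open>(x - c) * (x + c - \<mu>) = 0\<close> the second factor is then positive.\<close>
  have gt: "\<mu> < x" if "x > 0" "x * x = \<nu> + x * \<mu>" for x
  proof -
    have "x * \<mu> < x * x"
      using that \<nu> by simp
    then show ?thesis
      using that(1) by simp
  qed
  have root_unique: "x = c" if x: "x > 0" "x * x = \<nu> + x * \<mu>" for x
  proof -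
    have "(x - c) * (x + c - \<mu>) = 0"
      using x(2) c_eq by (simp add: algebra_simps)
    then show ?thesis
      using gt[OF x] c_pos by simp
  qed
  \<comment> \<open>Normalised to 1 on the cycle, so the cycle weight \<open>t\<close> of another
    solution is the scaling factor.\<close>
  define w :: "sun_vertex set \<Rightarrow> real" where "w e = (if \<exists>i j. Leaf i j \<in> e then 2 / c else 1)" for e
  interpret weighted_sun g d w
    using assms c_pos by unfold_locales (auto simp: positive_weighting_def w_def)
  have "discrete_Einstein E w"
    using c_pos c_eq by (intro Einstein_if_regular[of c]) (auto simp: \<mu>_def \<nu>_def w_def)
  moreover have "\<exists>t>0. \<forall>e\<in>E. w' e = t * w e" if Einstein: "discrete_Einstein E w'" for w'
  proof -
    interpret w': weighted_sun g d w'
      using assms Einstein by unfold_locales (auto simp: discrete_Einstein_def)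
    obtain t x where "0 < t" "0 < x" "x * x = 4 * real (d - 2) + x * cycle_min g"
      and w': "\<And>e. e \<in> E \<Longrightarrow> w' e = (if \<exists>i j. Leaf i j \<in> e then 2 * t / x else t)"
      using w'.regular_if_Einstein[OF Einstein] by metis
    moreover from this have "x = c"
      by (intro root_unique) (auto simp: \<mu>_def \<nu>_def)
    ultimately show ?thesis
      by (intro exI[of _ t]) (simp add: w_def)
  qed
  ultimately show ?thesis
    by blast
qed

end
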